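(* Let $\le$ be a binary relation on a set $S$. For relations $\preceq_1,\preceq_2$ on $S$ write $\preceq_1\,\to\,\preceq_2$ to mean that $\preceq_1$ is a subset of $\preceq_2$ (i.e. $\preceq_2$ is an augmentation of $\preceq_1$). Then: (a) For arbitrary $\Upsilon,\Theta\subseteq S^S$: $\le\;\to\;\le^{\mathrm{lin}}_{\Upsilon,\Theta}\;\to\;\le^{\mathrm{lin}}_{\mathrm{id},\Theta}\;\to\;\le^{\mathrm{slin}}_{\mathrm{id},\Theta}$. (b) For all $\Theta\subseteq S^S$: $\le^{\mathrm{lin}}_{\Theta,\Theta}$ and $\le^{\mathrm{slin}}_{\Theta,\Theta}$ are equal. (c) For all $\Upsilon,\Theta\subseteq S^S$ such that $\le$ is $\Theta$-linear and $\Theta\circ\Upsilon\subseteq\Theta$: $\le^{\mathrm{slin}}_{\mathrm{id},\Theta}\;\to\;\le^{\mathrm{cor}}_{\Upsilon,\Theta}$. (d) For all $\Lambda,\Pi\subseteq\mathrm{Endo}(S,\le)$: $\le^{\mathrm{str}}_{\Lambda,\Pi}\;\to\;\le^{\mathrm{cor}}_{\Lambda,\Pi}$. (e) For a quasi order $(O,\le)$ and all $\Lambda,\Pi\subseteq\mathrm{Endo}(O,\le)$, if $\Pi\circ\Lambda\subseteq\Lambda$ and $\Pi$ is a subsemigroup of $(\mathrm{Endo}(O,\le),\circ)$, then $\le^{\mathrm{str},\mathrm{tran}}_{\Lambda,\Pi}\;\to\;\le^{\mathrm{cor}}_{\Lambda,\Pi}$. (f) For arbitrary $\Upsilon,\Theta\subseteq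 S^S$: $\le^{-\mathrm{str}}_{\Upsilon,\Theta}\;\to\;\le^{\mathrm{cor}}_{\Upsilon,\Theta}$. (g) For every subsemigroup $\Pi$ of $(\mathrm{Endo}(S,\le),\circ)$: $\le^{-\mathrm{str}}_{\Pi,\Pi}\;\to\;\le^{\mathrm{lin}}_{\mathrm{id},\Pi}$.
   Context: $S^S$ is the set of all functions $S\to S$; $\mathrm{Endo}(S,\le)$ is the set of all $f\in S^S$ with $p\le q\Rightarrow f(p)\le f(q)$. $p<q$ means $p\le q$ and $q\nleq p$; $\nless$ is its negation. A quasi order is a reflexive transitive relation. For families of functions, $\Theta\circ\Upsilon=\{\tau\circ\sigma:\tau\in\Theta,\sigma\in\Upsilon\}$. A subscript $\mathrm{id}$ in place of a family means $\{\mathrm{id}_S\}$. $\le$ is $\Theta$-linear if for all $p,q\in S$ there is $\tau\in\Theta$ with $\tau(p)\le\tau(q)$ or $\tau(q)\le\tau(p)$. For $\Upsilon,\Theta\subseteq S^S$ the following relations on $S$ are defined: - $p\le^{\mathrm{lin}}_{\Upsilon,\Theta}q$ iff $p\le q$, or ($\sigma(p)\nleq\sigma(q)$ for all $\sigma\in\Upsilon$ and $\tau(q)\nleq\tau(p)$ for all $\tau\in\Theta$). - $p\le^{\mathrm{slin}}_{\Upsilon,\Theta}q$ iff $p\le q$, or ($\sigma(p)\nleq\sigma(q)$ for all $\sigma\in\Upsilon$ and $\tau(q)\nless\tau(p)$ for all $\tau\in\Theta$). - $p\le^{\mathrm{str}}_{\Upsilon,\Theta}q$ iff $p\le q$, or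 ($q<p$ and for every $\sigma\in\Upsilon$ there is $\tau\in\Theta$ with $\tau\sigma(q)\nless\tau\sigma(p)$). - $p\le^{\mathrm{cor}}_{\Upsilon,\Theta}q$ iff $p\le q$, or for every $\sigma\in\Upsilon$ there is $\tau\in\Theta$ with $\tau\sigma(p)\le\tau\sigma(q)$. - $p\le^{-\mathrm{str}}_{\Upsilon,\Theta}q$ iff $p\le q$, or for every $\sigma\in\Upsilon$ there is $\tau\in\Theta$ with $\tau\sigma(p)<\tau\sigma(q)$. - $\le^{\mathrm{str},\mathrm{tran}}_{\Upsilon,\Theta}$ is the transitive closure of $\le^{\mathrm{str}}_{\Upsilon,\Theta}$: $p$ is related to $q$ iff there is a finite chain $p=p_0\le^{\mathrm{str}}_{\Upsilon,\Theta}p_1\le^{\mathrm{str}}_{\Upsilon,\Theta}\cdots\le^{\mathrm{str}}_{\Upsilon,\Theta}p_{n-1}=q$. *)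

theory Defs
  imports "HOL-Library.FuncSet"
begin

text \<open>
  A binary relation on the set \<open>S\<close> is a set \<open>le \<subseteq> S \<times> S\<close> of pairs, and \<open>S\<^sup>S\<close> is the set
  \<open>S \<rightarrow>\<^sub>E S\<close> of maps that are \<open>undefined\<close> outside \<open>S\<close>, so that such maps are equal iff they agree
  on \<open>S\<close>.  Accordingly composition is \<open>compose S\<close>, and the identity of \<open>S\<close> is \<open>\<lambda>x\<in>S. x\<close>.
\<close>

definition Endo :: "'a set \<Rightarrow> 'a rel \<Rightarrow> ('a \<Rightarrow> 'a) set" where
  "Endo S le = {f \<in> S \<rightarrow>\<^sub>E S. \<forall>p\<in>S. \<forall>q\<in>S. (p, q) \<in> le \<longrightarrow> (f p, f q) \<in> le}"

definition less_rel :: "'a rel \<Rightarrow> 'a rel" where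
  "less_rel le = {(p, q). (p, q) \<in> le \<and> (q, p) \<notin> le}"

definition id_fam :: "'a set \<Rightarrow> ('a \<Rightarrow> 'a) set" where
  "id_fam S = {\<lambda>x\<in>S. x}"

definition comp_fam :: "'a set \<Rightarrow> ('a \<Rightarrow> 'a) set \<Rightarrow> ('a \<Rightarrow> 'a) set \<Rightarrow> ('a \<Rightarrow> 'a) set" where
  "comp_fam S \<Theta> \<Upsilon> = {compose S \<tau> \<sigma> | \<tau> \<sigma>. \<tau> \<in> \<Theta> \<and> \<sigma> \<in> \<Upsilon>}"

text \<open>The empty family counts as a subsemigroup.\<close>

definition subsemigroup_Endo :: "'a set \<Rightarrow> 'a rel \<Rightarrow> ('a \<Rightarrow> 'a) set \<Rightarrow> bool" where
  "subsemigroup_Endo S le P \<longleftrightarrow> P \<subseteq> Endo S le \<and> comp_fam S P P \<subseteq> P"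

definition fam_linear :: "'a set \<Rightarrow> 'a rel \<Rightarrow> ('a \<Rightarrow> 'a) set \<Rightarrow> bool" where
  "fam_linear S le \<Theta> \<longleftrightarrow>
     (\<forall>p\<in>S. \<forall>q\<in>S. \<exists>\<tau>\<in>\<Theta>. (\<tau> p, \<tau> q) \<in> le \<or> (\<tau> q, \<tau> p) \<in> le)"

definition le_lin :: "'a set \<Rightarrow> 'a rel \<Rightarrow> ('a \<Rightarrow> 'a) set \<Rightarrow> ('a \<Rightarrow> 'a) set \<Rightarrow> 'a rel" where
  "le_lin S le \<Upsilon> \<Theta> = {(p, q) \<in> S \<times> S. (p, q) \<in> le \<or>
     ((\<forall>\<sigma>\<in>\<Upsilon>. (\<sigma> p, \<sigma> q) \<notin> le) \<and> (\<forall>\<tau>\<in>\<Theta>. (\<tau> q, \<tau> p) \<notin> le))}"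

definition le_slin :: "'a set \<Rightarrow> 'a rel \<Rightarrow> ('a \<Rightarrow> 'a) set \<Rightarrow> ('a \<Rightarrow> 'a) set \<Rightarrow> 'a rel" where
  "le_slin S le \<Upsilon> \<Theta> = {(p, q) \<in> S \<times> S. (p, q) \<in> le \<or>
     ((\<forall>\<sigma>\<in>\<Upsilon>. (\<sigma> p, \<sigma> q) \<notin> le) \<and> (\<forall>\<tau>\<in>\<Theta>. (\<tau> q, \<tau> p) \<notin> less_rel le))}"

definition le_str :: "'a set \<Rightarrow> 'a rel \<Rightarrow> ('a \<Rightarrow> 'a) set \<Rightarrow> ('a \<Rightarrow> 'a) set \<Rightarrow> 'a rel" where
  "le_str S le \<Upsilon> \<Theta> = {(p, q) \<in> S \<times> S. (p, q) \<in> le \<or>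
     ((q, p) \<in> less_rel le \<and> (\<forall>\<sigma>\<in>\<Upsilon>. \<exists>\<tau>\<in>\<Theta>. (\<tau> (\<sigma> q), \<tau> (\<sigma> p)) \<notin> less_rel le))}"

definition le_cor :: "'a set \<Rightarrow> 'a rel \<Rightarrow> ('a \<Rightarrow> 'a) set \<Rightarrow> ('a \<Rightarrow> 'a) set \<Rightarrow> 'a rel" where
  "le_cor S le \<Upsilon> \<Theta> = {(p, q) \<in> S \<times> S. (p, q) \<in> le \<or>
     (\<forall>\<sigma>\<in>\<Upsilon>. \<exists>\<tau>\<in>\<Theta>. (\<tau> (\<sigma> p), \<tau> (\<sigma> q)) \<in> le)}"

text \<open>\<open>le_mstr\<close> is the relation written with superscript \<open>-str\<close>.\<close>

definition le_mstr :: "'a set \<Rightarrow> 'a rel \<Rightarrow> ('a \<Rightarrow> 'a) set \<Rightarrow> ('a \<Rightarrow> 'a) set \<Rightarrow> 'a rel" where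
  "le_mstr S le \<Upsilon> \<Theta> = {(p, q) \<in> S \<times> S. (p, q) \<in> le \<or>
     (\<forall>\<sigma>\<in>\<Upsilon>. \<exists>\<tau>\<in>\<Theta>. (\<tau> (\<sigma> p), \<tau> (\<sigma> q)) \<in> less_rel le)}"

text \<open>
  The chains of \<open>trancl\<close> have at least one step; over a reflexive \<open>le\<close> a chain without steps
  adds no pair, since \<open>le_str\<close> is then reflexive on \<open>S\<close>.
\<close>

definition le_str_tran :: "'a set \<Rightarrow> 'a rel \<Rightarrow> ('a \<Rightarrow> 'a) set \<Rightarrow> ('a \<Rightarrow> 'a) set \<Rightarrow> 'a rel" where
  "le_str_tran S le \<Upsilon> \<Theta> = (le_str S le \<Upsilon> \<Theta>)\<^sup>+"

end

theory Submission
  imports Defs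
begin

text \<open>Every inclusion concerns a pair with \<open>(p, q) \<notin> le\<close>, since
  \<open>le\<close> is a disjunct of each augmentation. Two observations then do most of the work.
  An inequality that holds but is not strict can be reversed: this gives
  \<open>le_lin_eq_le_slin\<close>, \<open>le_slin_id_subset_le_cor\<close> and
  \<open>le_str_subset_le_cor\<close>, where the inequality comes from the defining condition to be
  refuted, from linearity and from monotonicity respectively. Conversely, a monotone map cannot
  strictly reverse an inequality, which gives \<open>le_mstr_subset_le_lin_id\<close>.

  The deepest part is the transitive closure of \<open>le_str\<close>. Since \<open>le_str\<close>
  lies in \<open>le_cor\<close>, it suffices that \<open>le_cor\<close> is transitive
  (\<open>trans_le_cor\<close>). For this, a map that settles one link of a chain is absorbed into
  the left family before the next link is treated, and the two maps found are composed inside the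
  semigroup.\<close>

lemma Endo_funcset: "Endo S le \<subseteq> S \<rightarrow>\<^sub>E S"
  by (auto simp: Endo_def)

lemma Endo_closed: "f \<in> Endo S le \<Longrightarrow> p \<in> S \<Longrightarrow> f p \<in> S"
  using Endo_funcset by blast

lemma Endo_mono:
  "f \<in> Endo S le \<Longrightarrow> p \<in> S \<Longrightarrow> q \<in> S \<Longrightarrow> (p, q) \<in> le \<Longrightarrow> (f p, f q) \<in> le"
  by (auto simp: Endo_def)

lemma compose_in_comp_fam: "\<tau> \<in> \<Theta> \<Longrightarrow> \<sigma> \<in> \<Upsilon> \<Longrightarrow> compose S \<tau> \<sigma> \<in> comp_fam S \<Theta> \<Upsilon>"
  by (auto simp: comp_fam_def)

lemma le_subset_le_lin: "le \<subseteq> S \<times> S \<Longrightarrow> le \<subseteq> le_lin S le \<Upsilon> \<Theta>"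
  by (auto simp: le_lin_def)

text \<open>For the identity family the first condition of the second disjunct reads
  \<open>(p, q) \<notin> le\<close>, so it comes for free once the first disjunct fails.\<close>

lemma le_lin_subset_le_lin_id: "le_lin S le \<Upsilon> \<Theta> \<subseteq> le_lin S le (id_fam S) \<Theta>"
  by (auto simp: le_lin_def id_fam_def)

lemma le_lin_subset_le_slin: "le_lin S le \<Upsilon> \<Theta> \<subseteq> le_slin S le \<Upsilon> \<Theta>"
  by (auto simp: le_lin_def le_slin_def less_rel_def)

text \<open>The same \<open>\<tau>\<close> may be used in both conditions: the first excludes
  \<open>(\<tau> p, \<tau> q) \<in> le\<close>, so \<open>(\<tau> q, \<tau> p) \<in> le\<close>
  would already be strict.\<close>

lemma le_lin_eq_le_slin: "le_lin S le \<Theta> \<Theta> = le_slin S le \<Theta> \<Theta>"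
  by (auto simp: le_lin_def le_slin_def less_rel_def)

lemma le_slin_id_subset_le_cor:
  assumes \<Upsilon>: "\<Upsilon> \<subseteq> S \<rightarrow>\<^sub>E S" and lin: "fam_linear S le \<Theta>" and comp: "comp_fam S \<Theta> \<Upsilon> \<subseteq> \<Theta>"
  shows "le_slin S le (id_fam S) \<Theta> \<subseteq> le_cor S le \<Upsilon> \<Theta>"
proof clarify
  fix p q
  assume pq: "(p, q) \<in> le_slin S le (id_fam S) \<Theta>"
  then have S: "p \<in> S" "q \<in> S"
    by (auto simp: le_slin_def)
  have "\<exists>\<tau>\<in>\<Theta>. (\<tau> (\<sigma> p), \<tau> (\<sigma> q)) \<in> le" if "(p, q) \<notin> le" "\<sigma> \<in> \<Upsilon>" for \<sigma>
  proof -
    have "\<sigma> p \<in> S" "\<sigma> q \<in> S"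
      using that S \<Upsilon> by auto
    then obtain \<tau> where \<tau>: "\<tau> \<in> \<Theta>"
      and cmp: "(\<tau> (\<sigma> p), \<tau> (\<sigma> q)) \<in> le \<or> (\<tau> (\<sigma> q), \<tau> (\<sigma> p)) \<in> le"
      using lin by (auto simp: fam_linear_def)
    \<comment> \<open>Linearity compares the images under \<open>\<tau>\<close> of
      \<open>\<sigma> p\<close> and \<open>\<sigma> q\<close>, while \<open>le_slin\<close>
      restricts members of \<open>\<Theta>\<close> at \<open>p\<close> and \<open>q\<close>; the
      composite links the two.\<close>
    have "compose S \<tau> \<sigma> \<in> \<Theta>"
      using comp compose_in_comp_fam \<tau> that by blast
    then have "(compose S \<tau> \<sigma> q, compose S \<tau> \<sigma> p) \<notin> less_rel le"
      using pq that by (auto simp: le_slin_def)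
    then show ?thesis
      using cmp \<tau> S by (auto simp: compose_eq less_rel_def)
  qed
  then show "(p, q) \<in> le_cor S le \<Upsilon> \<Theta>"
    using S by (auto simp: le_cor_def)
qed

lemma le_str_subset_le_cor:
  assumes L: "L \<subseteq> Endo S le" and P: "P \<subseteq> Endo S le"
  shows "le_str S le L P \<subseteq> le_cor S le L P"
proof clarify
  fix p q
  assume pq: "(p, q) \<in> le_str S le L P"
  then have S: "p \<in> S" "q \<in> S"
    by (auto simp: le_str_def)
  have "\<exists>\<tau>\<in>P. (\<tau> (\<sigma> p), \<tau> (\<sigma> q)) \<in> le" if npq: "(p, q) \<notin> le" and \<sigma>: "\<sigma> \<in> L" for \<sigma>
  proof -
    have qp: "(q, p) \<in> le"
      using pq npq by (simp add: le_str_def less_rel_def)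
    obtain \<tau> where \<tau>: "\<tau> \<in> P" "(\<tau> (\<sigma> q), \<tau> (\<sigma> p)) \<notin> less_rel le"
      using pq npq \<sigma> by (auto simp: le_str_def)
    \<comment> \<open>Both maps preserve \<open>(q, p) \<in> le\<close>. As the result is not
      strict, its converse holds too, which is what \<open>le_cor\<close> asks for.\<close>
    have "(\<tau> (\<sigma> q), \<tau> (\<sigma> p)) \<in> le"
      using qp \<tau>(1) \<sigma> S L P by (blast intro: Endo_closed Endo_mono)
    then show ?thesis
      using \<tau> by (auto simp: less_rel_def)
  qed
  then show "(p, q) \<in> le_cor S le L P"
    using S by (auto simp: le_cor_def)
qed

text \<open>Given \<open>\<sigma>\<close>, the pair \<open>(p, q)\<close> yields some
  \<open>\<tau>\<close>; the pair \<open>(q, r)\<close> is then tested against the composite of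
  \<open>\<tau>\<close> after \<open>\<sigma>\<close>, a member of \<open>L\<close>, and yields
  \<open>\<rho>\<close>. The composite of \<open>\<rho>\<close> after \<open>\<tau>\<close> serves
  for \<open>(p, r)\<close>.\<close>

lemma trans_le_cor:
  assumes trans: "trans le" and L: "L \<subseteq> Endo S le" and P: "subsemigroup_Endo S le P"
    and PL: "comp_fam S P L \<subseteq> L"
  shows "trans (le_cor S le L P)"
proof (rule transI)
  fix p q r
  assume pq: "(p, q) \<in> le_cor S le L P" and qr: "(q, r) \<in> le_cor S le L P"
  then have S: "p \<in> S" "q \<in> S" "r \<in> S"
    by (auto simp: le_cor_def)
  have P': "P \<subseteq> Endo S le" "comp_fam S P P \<subseteq> P"
    using P by (auto simp: subsemigroup_Endo_def)
  have mono: "(\<tau> (\<sigma> x), \<tau> (\<sigma> y)) \<in> le"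
    if "\<sigma> \<in> L" "\<tau> \<in> P" "x \<in> S" "y \<in> S" "(x, y) \<in> le" for \<sigma> \<tau> x y
    using that L P' by (blast intro: Endo_closed Endo_mono)
  have "\<exists>\<tau>\<in>P. (\<tau> (\<sigma> p), \<tau> (\<sigma> r)) \<in> le" if npr: "(p, r) \<notin> le" and \<sigma>: "\<sigma> \<in> L" for \<sigma>
  proof -
    \<comment> \<open>Both pairs cannot lie in \<open>le\<close>, by transitivity. If just one does,
      monotonicity carries it along the map found for the other.\<close>
    consider "(p, q) \<in> le" "(q, r) \<notin> le" | "(p, q) \<notin> le" "(q, r) \<in> le"
      | "(p, q) \<notin> le" "(q, r) \<notin> le"
      using npr transD[OF trans] by blast
    then show ?thesis
    proof cases
      case 1
      then obtain \<tau> where "\<tau> \<in> P" "(\<tau> (\<sigma> q), \<tau> (\<sigma> r)) \<in> le"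
        using qr \<sigma> by (auto simp: le_cor_def)
      moreover from this(1) have "(\<tau> (\<sigma> p), \<tau> (\<sigma> q)) \<in> le"
        using 1 mono S \<sigma> by blast
      ultimately show ?thesis
        using transD[OF trans] by blast
    next
      case 2
      then obtain \<tau> where "\<tau> \<in> P" "(\<tau> (\<sigma> p), \<tau> (\<sigma> q)) \<in> le"
        using pq \<sigma> by (auto simp: le_cor_def)
      moreover from this(1) have "(\<tau> (\<sigma> q), \<tau> (\<sigma> r)) \<in> le"
        using 2 mono S \<sigma> by blast
      ultimately show ?thesis
        using transD[OF trans] by blast
    next
      case 3
      then obtain \<tau> where \<tau>: "\<tau> \<in> P" "(\<tau> (\<sigma> p), \<tau> (\<sigma> q)) \<in> le"
        using pq \<sigma> by (auto simp: le_cor_def)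
      have "compose S \<tau> \<sigma> \<in> L"
        using PL compose_in_comp_fam \<tau> \<sigma> by blast
      then obtain \<rho> where \<rho>: "\<rho> \<in> P" "(\<rho> (compose S \<tau> \<sigma> q), \<rho> (compose S \<tau> \<sigma> r)) \<in> le"
        using qr 3 by (auto simp: le_cor_def)
      have \<sigma>S: "\<sigma> p \<in> S" "\<sigma> q \<in> S" "\<sigma> r \<in> S"
        using \<sigma> L S by (auto intro: Endo_closed)
      \<comment> \<open>Applying the monotone \<open>\<rho>\<close> moves the first link to the
        level where the second one holds, so that the two can be chained.\<close>
      then have "(\<rho> (\<tau> (\<sigma> p)), \<rho> (\<tau> (\<sigma> q))) \<in> le"
        using \<tau> \<rho>(1) P' by (blast intro: Endo_closed Endo_mono)
      then have "(\<rho> (\<tau> (\<sigma> p)), \<rho> (\<tau> (\<sigma> r))) \<in> le"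
        using \<rho>(2) S transD[OF trans] by (simp add: compose_eq)
      moreover have "compose S \<rho> \<tau> \<in> P"
        using P' compose_in_comp_fam \<tau> \<rho> by blast
      ultimately show ?thesis
        \<comment> \<open>\<open>compose S\<close> is meaningful only on \<open>S\<close>, hence the
          need for \<open>\<sigma> p\<close> and \<open>\<sigma> r\<close> to lie there.\<close>
        using \<sigma>S by (auto simp: compose_eq intro!: bexI[of _ "compose S \<rho> \<tau>"])
    qed
  qed
  then show "(p, r) \<in> le_cor S le L P"
    using S by (auto simp: le_cor_def)
qed

lemma le_str_tran_subset_le_cor:
  assumes "trans le" "L \<subseteq> Endo S le" "subsemigroup_Endo S le P" "comp_fam S P L \<subseteq> L"
  shows "le_str_tran S le L P \<subseteq> le_cor S le L P"
proof -
  have "le_str S le L P \<subseteq> le_cor S le L P"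
    using assms by (intro le_str_subset_le_cor) (auto simp: subsemigroup_Endo_def)
  then have "(le_str S le L P)\<^sup>+ \<subseteq> (le_cor S le L P)\<^sup>+"
    by (auto intro: trancl_mono)
  then show ?thesis
    \<comment> \<open>A transitive relation equals its own transitive closure.\<close>
    using trans_le_cor[OF assms] by (simp add: le_str_tran_def)
qed

lemma le_mstr_subset_le_cor: "le_mstr S le \<Upsilon> \<Theta> \<subseteq> le_cor S le \<Upsilon> \<Theta>"
  by (fastforce simp: le_mstr_def le_cor_def less_rel_def)

lemma le_mstr_subset_le_lin_id:
  assumes P: "P \<subseteq> Endo S le"
  shows "le_mstr S le P P \<subseteq> le_lin S le (id_fam S) P"
proof clarify
  fix p q
  assume pq: "(p, q) \<in> le_mstr S le P P"
  then have S: "p \<in> S" "q \<in> S"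
    by (auto simp: le_mstr_def)
  have "(\<tau> q, \<tau> p) \<notin> le" if npq: "(p, q) \<notin> le" and \<tau>: "\<tau> \<in> P" for \<tau>
  proof
    assume le: "(\<tau> q, \<tau> p) \<in> le"
    obtain \<rho> where \<rho>: "\<rho> \<in> P" "(\<rho> (\<tau> p), \<rho> (\<tau> q)) \<in> less_rel le"
      using pq npq \<tau> by (auto simp: le_mstr_def)
    \<comment> \<open>Monotonicity of \<open>\<rho>\<close> preserves the assumed inequality,
      against the strict one in the other direction.\<close>
    have "(\<rho> (\<tau> q), \<rho> (\<tau> p)) \<in> le"
      using le \<rho>(1) \<tau> S P by (blast intro: Endo_closed Endo_mono)
    with \<rho>(2) show False
      by (simp add: less_rel_def)
  qed
  then show "(p, q) \<in> le_lin S le (id_fam S) P"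
    using S by (auto simp: le_lin_def id_fam_def)
qed

theorem theorem4p14:
  fixes S :: "'a set" and le :: "'a rel"
    and Q :: "'b set" and leQ :: "'b rel"
  assumes le_on_S: "le \<subseteq> S \<times> S"
  shows
    "(\<forall>\<Upsilon> \<Theta>. \<Upsilon> \<subseteq> S \<rightarrow>\<^sub>E S \<and> \<Theta> \<subseteq> S \<rightarrow>\<^sub>E S \<longrightarrow>
        le \<subseteq> le_lin S le \<Upsilon> \<Theta> \<and>
        le_lin S le \<Upsilon> \<Theta> \<subseteq> le_lin S le (id_fam S) \<Theta> \<and>
        le_lin S le (id_fam S) \<Theta> \<subseteq> le_slin S le (id_fam S) \<Theta>) \<and>
     (\<forall>\<Theta>. \<Theta> \<subseteq> S \<rightarrow>\<^sub>E S \<longrightarrow> le_lin S le \<Theta> \<Theta> = le_slin S le \<Theta> \<Theta>) \<and>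
     (\<forall>\<Upsilon> \<Theta>. \<Upsilon> \<subseteq> S \<rightarrow>\<^sub>E S \<and> \<Theta> \<subseteq> S \<rightarrow>\<^sub>E S \<and>
        fam_linear S le \<Theta> \<and> comp_fam S \<Theta> \<Upsilon> \<subseteq> \<Theta> \<longrightarrow>
        le_slin S le (id_fam S) \<Theta> \<subseteq> le_cor S le \<Upsilon> \<Theta>) \<and>
     (\<forall>L P. L \<subseteq> Endo S le \<and> P \<subseteq> Endo S le \<longrightarrow>
        le_str S le L P \<subseteq> le_cor S le L P) \<and>
     (\<forall>L P. preorder_on Q leQ \<and> L \<subseteq> Endo Q leQ \<and> P \<subseteq> Endo Q leQ \<and>
        comp_fam Q P L \<subseteq> L \<and> subsemigroup_Endo Q leQ P \<longrightarrow>
        le_str_tran Q leQ L P \<subseteq> le_cor Q leQ L P) \<and>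
     (\<forall>\<Upsilon> \<Theta>. \<Upsilon> \<subseteq> S \<rightarrow>\<^sub>E S \<and> \<Theta> \<subseteq> S \<rightarrow>\<^sub>E S \<longrightarrow>
        le_mstr S le \<Upsilon> \<Theta> \<subseteq> le_cor S le \<Upsilon> \<Theta>) \<and>
     (\<forall>P. subsemigroup_Endo S le P \<longrightarrow>
        le_mstr S le P P \<subseteq> le_lin S le (id_fam S) P)"
proof (intro conjI allI impI; (elim conjE)?)
  show "le \<subseteq> le_lin S le \<Upsilon> \<Theta>" for \<Upsilon> \<Theta>
    using le_on_S by (rule le_subset_le_lin)
  show "le_slin S le (id_fam S) \<Theta> \<subseteq> le_cor S le \<Upsilon> \<Theta>"
    if "\<Upsilon> \<subseteq> S \<rightarrow>\<^sub>E S" "fam_linear S le \<Theta>" "comp_fam S \<Theta> \<Upsilon> \<subseteq> \<Theta>" for \<Upsilon> \<Theta>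
    using that by (rule le_slin_id_subset_le_cor)
  show "le_str S le L P \<subseteq> le_cor S le L P" if "L \<subseteq> Endo S le" "P \<subseteq> Endo S le" for L P
    using that by (rule le_str_subset_le_cor)
  show "le_str_tran Q leQ L P \<subseteq> le_cor Q leQ L P"
    if "preorder_on Q leQ" "L \<subseteq> Endo Q leQ" "comp_fam Q P L \<subseteq> L" "subsemigroup_Endo Q leQ P" for L P
    using that by (intro le_str_tran_subset_le_cor) (auto simp: preorder_on_def)
  show "le_mstr S le P P \<subseteq> le_lin S le (id_fam S) P" if "subsemigroup_Endo S le P" for P
    using that by (intro le_mstr_subset_le_lin_id) (simp add: subsemigroup_Endo_def)
\<comment> \<open>The goals left are the four relations that hold for arbitrary families.\<close>
qed (rule le_lin_subset_le_lin_id le_lin_subset_le_slin le_lin_eq_le_slin le_mstr_subset_le_cor)+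

end
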